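(* Let $\mathbf{K}$ be a convex body in $\mathbb{S}^d$. Then $I_{\mathbb{S}^d}(\mathbf{K})$ is equal to the minimum number of open hemispheres of $\mathbb{S}^d$ whose boundaries all pass through a common point in the interior of the polar convex body $\mathbf{K}^*$ and which have the property that every exposed face of $\mathbf{K}^*$ is contained in at least one of the open hemispheres.
   Context: $\mathbb{S}^d$ denotes the unit sphere of Euclidean space $\mathbb{E}^{d+1}$ centered at the origin, with $\langle\cdot,\cdot\rangle$ the standard inner product. A subset of $\mathbb{S}^d$ is spherically convex if it is contained in an open hemisphere of $\mathbb{S}^d$ and, for any two of its points, it contains the spherical segment (the shorter unit circle arc) connecting them. A convex body in $\mathbb{S}^d$ is a compact spherically convex set with nonempty interior. The polar body of a convex body $\mathbf{K}\subset\mathbb{S}^d$ is $\mathbf{K}^*:=\{\mathbf{x}\in\mathbb{S}^d:\langle\mathbf{x},\mathbf{y}\rangle\le 0\text{ for all }\mathbf{y}\in\mathbf{K}\}$; it is a convex body in $\mathbb{S}^d$. An exposed face of a convex body in $\mathbb{S}^d$ is the intersection of the body with a supporting $(d-1)$-dimensional greatsphere of it (a greatsphere that meets the body and bounds a closed hemisphere containing it). Illumination: let $\mathbf{p}\in\mathbb{S}^d\setminus\mathbf{K}$. A boundary point $\mathbf{q}\in\operatorname{bd}\mathbf{K}$ is illuminated from $\mathbf{p}$ if $\mathbf{q}\neq-\mathbf{p}$, the spherical segment with endpoints $\mathbf{p},\mathbf{q}$ does not intersect $\operatorname{int}\mathbf{K}$, and the greatcircle through $\mathbf{p}$ and $\mathbf{q}$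 does intersect $\operatorname{int}\mathbf{K}$. $\mathbf{K}$ is illuminated from a set $S\subset\mathbb{S}^d\setminus\mathbf{K}$ if every boundary point of $\mathbf{K}$ is illuminated from at least one point of $S$. The illumination number $I_{\mathbb{S}^d}(\mathbf{K})$ is the smallest cardinality of a set $S$ that illuminates $\mathbf{K}$ and lies on a $(d-1)$-dimensional greatsphere of $\mathbb{S}^d$ disjoint from $\mathbf{K}$. *)

theory Defs
  imports "HOL-Analysis.Analysis" "HOL-Library.Extended_Nat"
begin

text \<open>
  The sphere of dimension \<open>d\<close> is \<open>sphere 0 1\<close> in a Euclidean space \<open>'a\<close> with
  \<open>DIM('a) = d + 1\<close>; interior and boundary are taken in its subspace topology.
\<close>

abbreviation usphere :: "'a::euclidean_space set" where
  "usphere \<equiv> sphere 0 1"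

abbreviation sph_interior :: "'a::euclidean_space set \<Rightarrow> 'a set" where
  "sph_interior A \<equiv> top_of_set usphere interior_of A"

abbreviation sph_boundary :: "'a::euclidean_space set \<Rightarrow> 'a set" where
  "sph_boundary A \<equiv> top_of_set usphere frontier_of A"

definition open_hemisphere :: "'a::euclidean_space \<Rightarrow> 'a set" where
  "open_hemisphere u = {x \<in> usphere. u \<bullet> x > 0}"

definition closed_hemisphere :: "'a::euclidean_space \<Rightarrow> 'a set" where
  "closed_hemisphere u = {x \<in> usphere. u \<bullet> x \<ge> 0}"

text \<open>The greatsphere of codimension one with unit normal \<open>u\<close>.\<close>

definition great_hypersphere :: "'a::euclidean_space \<Rightarrow> 'a set" where
  "great_hypersphere u = {x \<in> usphere. u \<bullet> x = 0}"

text \<open>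
  The next two sets are the greatcircle through \<open>x\<close>, \<open>y\<close> and its shorter arc between them
  only for \<open>x \<noteq> y\<close> and \<open>x \<noteq> -y\<close> on the unit sphere; for \<open>x = y\<close> the arc is \<open>{x}\<close>.
  They are never used for antipodal points, and the greatcircle never for equal ones.
\<close>

definition great_circle :: "'a::euclidean_space \<Rightarrow> 'a \<Rightarrow> 'a set" where
  "great_circle x y = usphere \<inter> span {x, y}"

definition sph_segment :: "'a::euclidean_space \<Rightarrow> 'a \<Rightarrow> 'a set" where
  "sph_segment x y =
    {z \<in> usphere. \<exists>a b. a \<ge> 0 \<and> b \<ge> 0 \<and> z = a *\<^sub>R x + b *\<^sub>R y}"

definition sph_convex :: "'a::euclidean_space set \<Rightarrow> bool" where
  "sph_convex A \<longleftrightarrow>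
    (\<exists>u\<in>usphere. A \<subseteq> open_hemisphere u) \<and> (\<forall>x\<in>A. \<forall>y\<in>A. sph_segment x y \<subseteq> A)"

definition sph_convex_body :: "'a::euclidean_space set \<Rightarrow> bool" where
  "sph_convex_body K \<longleftrightarrow> compact K \<and> sph_convex K \<and> sph_interior K \<noteq> {}"

definition sph_polar :: "'a::euclidean_space set \<Rightarrow> 'a set" where
  "sph_polar K = {x \<in> usphere. \<forall>y\<in>K. x \<bullet> y \<le> 0}"

definition sph_exposed_face_of :: "'a::euclidean_space set \<Rightarrow> 'a set \<Rightarrow> bool" where
  "sph_exposed_face_of F K \<longleftrightarrow>
    (\<exists>u\<in>usphere. great_hypersphere u \<inter> K \<noteq> {} \<and> K \<subseteq> closed_hemisphere u \<and>
                 F = K \<inter> great_hypersphere u)"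

definition illuminated_from :: "'a::euclidean_space set \<Rightarrow> 'a \<Rightarrow> 'a \<Rightarrow> bool" where
  "illuminated_from K p q \<longleftrightarrow>
    q \<noteq> - p \<and> sph_segment p q \<inter> sph_interior K = {} \<and>
    great_circle p q \<inter> sph_interior K \<noteq> {}"

definition illuminates :: "'a::euclidean_space set \<Rightarrow> 'a set \<Rightarrow> bool" where
  "illuminates S K \<longleftrightarrow>
    S \<subseteq> usphere - K \<and> (\<forall>q\<in>sph_boundary K. \<exists>p\<in>S. illuminated_from K p q)"

text \<open>With values in \<^typ>\<open>enat\<close>, the infimum is \<open>\<infinity>\<close> if there is no finite illuminating set.\<close>

definition illumination_number :: "'a::euclidean_space set \<Rightarrow> enat" where
  "illumination_number K =
    Inf {enat (card S) | S. finite S \<and> illuminates S K \<and>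
           (\<exists>u\<in>usphere. great_hypersphere u \<inter> K = {} \<and> S \<subseteq> great_hypersphere u)}"

definition hemisphere_cover_of_polar_faces ::
    "'a::euclidean_space set \<Rightarrow> 'a set set \<Rightarrow> bool" where
  "hemisphere_cover_of_polar_faces K \<H> \<longleftrightarrow>
    \<H> \<subseteq> open_hemisphere ` usphere \<and>
    (\<exists>z\<in>sph_interior (sph_polar K). \<forall>H\<in>\<H>. z \<in> sph_boundary H) \<and>
    (\<forall>F. sph_exposed_face_of F (sph_polar K) \<longrightarrow> (\<exists>H\<in>\<H>. F \<subseteq> H))"

end

theory Submission
  imports Defs
begin

text \<open>
  Let \<open>z\<close> be a point with \<open>z \<bullet> y < 0\<close> on \<open>K\<close>, that is, an interior point of the polar body,
  and let \<open>p\<close> be a unit vector orthogonal to \<open>z\<close>. A boundary point \<open>q\<close> of \<open>K\<close> is illuminated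
  from \<open>p\<close> iff \<open>q - s p\<close> points into the interior of the cone over \<open>K\<close> for some \<open>s > 0\<close>. By the
  bipolar theorem this means that every \<open>x\<close> in the polar body with \<open>x \<bullet> q = 0\<close> satisfies
  \<open>p \<bullet> x > 0\<close>: the exposed face of the polar body cut out by \<open>q\<close> lies in the open hemisphere
  centred at \<open>p\<close>. Every exposed face of the polar body arises from such a \<open>q\<close>, so
  \<open>p \<mapsto> open_hemisphere p\<close> is a cardinality preserving correspondence between illuminating sets
  and hemisphere covers. Finite ones exist because the boundary of \<open>K\<close> is compact and the
  illumination condition is open in \<open>q\<close>.
\<close>

section \<open>Interiors on the sphere, polars and the bipolar theorem\<close>

text \<open>Compactness makes strict negativity uniform: the maximum \<open>m \<bullet> y\<close>
  over \<open>C\<close> is negative, and the norm bound \<open>B\<close> with Cauchy-Schwarz turns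
  that gap into a radius around \<open>y\<close>.\<close>

lemma open_inner_less_zero:
  fixes C :: "'a::euclidean_space set"
  assumes "compact C"
  shows "open {y. \<forall>x\<in>C. x \<bullet> y < 0}"
proof (cases "C = {}")
  case False
  show ?thesis
    unfolding open_dist
  proof (intro ballI)
    fix y assume "y \<in> {y. \<forall>x\<in>C. x \<bullet> y < 0}"
    then have y: "\<And>x. x \<in> C \<Longrightarrow> x \<bullet> y < 0" by simp
    have "continuous_on C (\<lambda>x. x \<bullet> y)" by (intro continuous_intros)
    then obtain m where m: "m \<in> C" "\<And>x. x \<in> C \<Longrightarrow> x \<bullet> y \<le> m \<bullet> y"
      using continuous_attains_sup[OF assms False] by blast
    obtain B where B: "B > 0" "\<And>x. x \<in> C \<Longrightarrow> norm x \<le> B"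
      using compact_imp_bounded[OF assms] bounded_pos by metis
    have "x \<bullet> w < 0" if "dist w y < - (m \<bullet> y) / B" "x \<in> C" for x w
    proof -
      have "x \<bullet> (w - y) \<le> norm x * norm (w - y)" by (rule norm_cauchy_schwarz)
      also have "\<dots> \<le> B * norm (w - y)" using B that by (intro mult_right_mono) auto
      also have "\<dots> < - (m \<bullet> y)" using that(1) B(1) by (simp add: dist_norm field_simps)
      finally show ?thesis using m(2)[OF that(2)] by (simp add: inner_diff_right)
    qed
    moreover have "- (m \<bullet> y) / B > 0" using y[OF m(1)] B(1) by (simp add: field_simps)
    ultimately show "\<exists>e>0. \<forall>w. dist w y < e \<longrightarrow> w \<in> {y. \<forall>x\<in>C. x \<bullet> y < 0}"
      by blast
  qed
qed auto

text \<open>Lets an interior point be tested by linear motion: move a little in any direction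
  \<open>v\<close> and renormalise with \<open>sgn\<close>, which is continuous away from 0.\<close>

lemma sph_interior_perturb:
  fixes A :: "'a::euclidean_space set"
  assumes "y \<in> sph_interior A"
  obtains e where "e > 0" "y + e *\<^sub>R v \<noteq> 0" "sgn (y + e *\<^sub>R v) \<in> A"
proof -
  obtain T where T: "openin (top_of_set usphere) T" "y \<in> T" "T \<subseteq> A"
    using assms unfolding interior_of_def by blast
  then obtain U where U: "open U" "T = usphere \<inter> U" by (metis openin_open)
  have y: "y \<in> U" "norm y = 1" "y \<noteq> 0" using T U by auto
  have lim: "((\<lambda>e. y + e *\<^sub>R v) \<longlongrightarrow> y + 0 *\<^sub>R v) (at_right 0)"
    by (intro tendsto_intros)
  then have "((\<lambda>e. sgn (y + e *\<^sub>R v)) \<longlongrightarrow> sgn y) (at_right 0)"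
    using y by (intro tendsto_sgn) auto
  moreover have "sgn y = y" using y by (simp add: sgn_div_norm)
  ultimately have "\<forall>\<^sub>F e in at_right 0. sgn (y + e *\<^sub>R v) \<in> U"
    using U(1) y(1) by (auto dest: topological_tendstoD)
  moreover have "\<forall>\<^sub>F e in at_right 0. y + e *\<^sub>R v \<noteq> 0"
    using lim y by (auto intro: tendsto_imp_eventually_ne)
  moreover have "\<forall>\<^sub>F e in at_right 0. e > (0::real)" by (simp add: eventually_at_right_less)
  ultimately have "\<forall>\<^sub>F e in at_right 0. e > (0::real) \<and> y + e *\<^sub>R v \<noteq> 0 \<and> sgn (y + e *\<^sub>R v) \<in> U"
    by eventually_elim auto
  then obtain e where e: "e > (0::real)" "y + e *\<^sub>R v \<noteq> 0" "sgn (y + e *\<^sub>R v) \<in> U"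
    using eventually_happens' trivial_limit_at_right_real by blast
  then have "sgn (y + e *\<^sub>R v) \<in> A" using T(3) U(2) by (auto simp: norm_sgn)
  with e that show thesis by blast
qed

text \<open>Strict inequalities over a compact set define an open condition, so they give interior
  points. Conversely, pushing an interior point \<open>y\<close> towards some \<open>x\<close> in
  \<open>A\<close> adds a positive multiple of \<open>x \<bullet> x\<close> to
  \<open>x \<bullet> y\<close>, so equality there would leave the polar.\<close>

lemma sph_interior_polar:
  fixes A :: "'a::euclidean_space set"
  assumes "compact A" "A \<subseteq> usphere"
  shows "sph_interior (sph_polar A) = {y \<in> usphere. \<forall>x\<in>A. x \<bullet> y < 0}"
proof
  show "{y \<in> usphere. \<forall>x\<in>A. x \<bullet> y < 0} \<subseteq> sph_interior (sph_polar A)"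
  proof (rule interior_of_maximal)
    show "{y \<in> usphere. \<forall>x\<in>A. x \<bullet> y < 0} \<subseteq> sph_polar A"
      by (auto simp: sph_polar_def inner_commute intro: less_imp_le)
    have "{y \<in> usphere. \<forall>x\<in>A. x \<bullet> y < 0} = usphere \<inter> {y. \<forall>x\<in>A. x \<bullet> y < 0}" by auto
    then show "openin (top_of_set usphere) {y \<in> usphere. \<forall>x\<in>A. x \<bullet> y < 0}"
      using openin_open_Int[OF open_inner_less_zero[OF assms(1)]] by simp
  qed
next
  show "sph_interior (sph_polar A) \<subseteq> {y \<in> usphere. \<forall>x\<in>A. x \<bullet> y < 0}"
  proof (intro subsetI CollectI conjI ballI)
    fix y assume y: "y \<in> sph_interior (sph_polar A)"
    then have "y \<in> sph_polar A" by (rule subsetD[OF interior_of_subset])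
    then show "y \<in> usphere" by (simp add: sph_polar_def)
    fix x assume x: "x \<in> A"
    obtain e where e: "e > 0" "y + e *\<^sub>R x \<noteq> 0" "sgn (y + e *\<^sub>R x) \<in> sph_polar A"
      by (rule sph_interior_perturb[OF y])
    then have "sgn (y + e *\<^sub>R x) \<bullet> x \<le> 0" using x by (auto simp: sph_polar_def)
    then have "(y + e *\<^sub>R x) \<bullet> x \<le> 0"
      using e(2) unfolding sgn_div_norm inner_scaleR_left by (auto simp: mult_le_0_iff)
    then have "x \<bullet> y + e * (x \<bullet> x) \<le> 0" by (simp add: inner_add_left inner_commute[of y x])
    moreover have "x \<noteq> 0" using x assms(2) by auto
    then have "e * (x \<bullet> x) > 0" using e(1) by simp
    ultimately show "x \<bullet> y < 0" by linarith
  qed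
qed

lemma compact_sph_polar: "compact (sph_polar A)"
proof -
  have "sph_polar A = usphere \<inter> (\<Inter>y\<in>A. {x. x \<bullet> y \<le> 0})"
    by (auto simp: sph_polar_def)
  moreover have "closed (\<Inter>y\<in>A. {x. x \<bullet> y \<le> 0})"
    by (intro closed_INT ballI closed_Collect_le continuous_intros)
  ultimately show ?thesis by (simp add: compact_Int_closed)
qed

text \<open>The cone \<open>C\<close> over \<open>K\<close> is closed and convex, so a unit vector
  outside it is cut off by a hyperplane; the negated normal of that hyperplane, normalised, lies in
  the polar and contradicts membership in the bipolar.\<close>

lemma sph_polar_polar:
  fixes K :: "'a::euclidean_space set"
  assumes "compact K" "sph_convex K" "K \<noteq> {}"
  shows "sph_polar (sph_polar K) = K"
proof
  obtain u where u: "u \<in> usphere" "K \<subseteq> open_hemisphere u"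
    using assms(2) by (auto simp: sph_convex_def)
  then have Ksp: "K \<subseteq> usphere" by (auto simp: open_hemisphere_def)
  then show "K \<subseteq> sph_polar (sph_polar K)"
    by (auto simp: sph_polar_def inner_commute)
  define C where "C = conic hull K"
  have C: "C = {c *\<^sub>R x | c x. 0 \<le> c \<and> x \<in> K}"
    by (simp add: C_def conic_hull_explicit)
  \<comment> \<open>The conic hull of a compact set is closed provided the set avoids the
    origin.\<close>
  have "0 \<notin> K" using Ksp by auto
  then have "closed C" unfolding C_def using assms(1) closed_conic_hull by blast
  \<comment> \<open>Convexity of a cone reduces to closure under addition. A nonzero sum, once
    normalised, lies on the spherical segment between the two generating points of \<open>K\<close>;
    a zero sum is treated apart because \<open>sgn 0 = 0\<close> is off the sphere.\<close>
  have "x + y \<in> C" if xy: "x \<in> C" "y \<in> C" for x y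
  proof (cases "x + y = 0")
    case True
    then show ?thesis using assms(3) by (simp add: C_def)
  next
    case False
    obtain a b v w where *: "x = a *\<^sub>R v" "y = b *\<^sub>R w" "a \<ge> 0" "b \<ge> 0" "v \<in> K" "w \<in> K"
      using xy unfolding C by blast
    have "sgn (x + y) = (a / norm (x + y)) *\<^sub>R v + (b / norm (x + y)) *\<^sub>R w"
      by (simp add: sgn_div_norm * scaleR_add_right divide_inverse_commute)
    moreover have "a / norm (x + y) \<ge> 0" "b / norm (x + y) \<ge> 0" using * by auto
    moreover have "sgn (x + y) \<in> usphere" using False by (simp add: norm_sgn)
    ultimately have "sgn (x + y) \<in> sph_segment v w" unfolding sph_segment_def by blast
    then have "sgn (x + y) \<in> K" using assms(2) * by (auto simp: sph_convex_def)
    moreover have "x + y = norm (x + y) *\<^sub>R sgn (x + y)" using False by (simp add: sgn_div_norm)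
    ultimately show ?thesis unfolding C by (metis (mono_tags, lifting) CollectI norm_ge_zero)
  qed
  moreover have "conic C" by (simp add: C_def conic_conic_hull)
  ultimately have "convex C"
    by (auto simp: convex_def conic_def)
  show "sph_polar (sph_polar K) \<subseteq> K"
  proof
    fix y assume y: "y \<in> sph_polar (sph_polar K)"
    then have ny: "norm y = 1" by (simp add: sph_polar_def)
    show "y \<in> K"
    proof (rule ccontr)
      assume "y \<notin> K"
      have "y \<notin> C"
      proof
        assume "y \<in> C"
        then obtain c x where c: "y = c *\<^sub>R x" "c \<ge> 0" "x \<in> K" unfolding C by blast
        then have "c = 1" using ny Ksp by auto
        then show False using c \<open>y \<notin> K\<close> by simp
      qed
      then obtain a b where ab: "a \<bullet> y < b" "\<And>x. x \<in> C \<Longrightarrow> a \<bullet> x > b"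
        using separating_hyperplane_closed_point[OF \<open>convex C\<close> \<open>closed C\<close>] by blast
      have "0 \<in> C" using assms(3) by (simp add: C_def)
      then have "b < 0" using ab(2) by fastforce
      then have ay: "a \<bullet> y < 0" using ab(1) by simp
      have "a \<bullet> x \<ge> 0" if "x \<in> K" for x
      proof (rule ccontr)
        assume "\<not> a \<bullet> x \<ge> 0"
        then have "a \<bullet> x < 0" by simp
        \<comment> \<open>A functional bounded below on a cone cannot be negative there: this
          multiple of \<open>x\<close> attains the value \<open>b\<close> exactly, against the
          strict bound.\<close>
        moreover have "(b / (a \<bullet> x)) *\<^sub>R x \<in> C"
          using that \<open>b < 0\<close> \<open>a \<bullet> x < 0\<close> unfolding C
          by (intro CollectI exI[of _ "b / (a \<bullet> x)"] exI[of _ x]) (simp add: divide_nonpos_nonpos)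
        ultimately show False using ab(2)[of "(b / (a \<bullet> x)) *\<^sub>R x"] by simp
      qed
      moreover have "a \<noteq> 0" using ay by auto
      ultimately have "sgn (- a) \<in> sph_polar K"
        by (auto simp: sph_polar_def norm_sgn sgn_div_norm)
      then have "y \<bullet> sgn (- a) \<le> 0" using y by (auto simp: sph_polar_def)
      then have "a \<bullet> y \<ge> 0" using \<open>a \<noteq> 0\<close>
        by (simp add: sgn_div_norm inner_commute zero_le_mult_iff)
      then show False using ay by simp
    qed
  qed
qed

section \<open>Open hemispheres: boundary and uniqueness of the centre\<close>

text \<open>Points with \<open>p \<bullet> x = 0\<close> lie in the closure because a small push
  towards \<open>p\<close> moves them into the open hemisphere.\<close>

lemma sph_boundary_open_hemisphere:
  fixes p :: "'a::euclidean_space"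
  assumes "p \<in> usphere"
  shows "sph_boundary (open_hemisphere p) = great_hypersphere p"
proof -
  let ?S = "usphere :: 'a set" and ?H = "open_hemisphere p"
  have "?H = ?S \<inter> {x. p \<bullet> x > 0}" by (auto simp: open_hemisphere_def)
  then have int: "sph_interior ?H = ?H"
    by (intro interior_of_openin) (metis openin_open open_halfspace_gt)
  have "closed_hemisphere p = ?S \<inter> {x. p \<bullet> x \<ge> 0}" by (auto simp: closed_hemisphere_def)
  then have "closedin (top_of_set ?S) (closed_hemisphere p)"
    by (metis closedin_closed closed_halfspace_ge)
  then have 1: "top_of_set ?S closure_of ?H \<subseteq> closed_hemisphere p"
    by (intro closure_of_minimal) (auto simp: open_hemisphere_def closed_hemisphere_def)
  have 2: "x \<in> top_of_set ?S closure_of ?H" if x: "x \<in> great_hypersphere p" for x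
    unfolding in_closure_of
  proof (intro conjI allI impI)
    show "x \<in> topspace (top_of_set ?S)" using x by (simp add: great_hypersphere_def)
    fix T assume "x \<in> T \<and> openin (top_of_set ?S) T"
    then have "x \<in> sph_interior T" by (simp add: interior_of_openin)
    then obtain e where e: "e > 0" "x + e *\<^sub>R p \<noteq> 0" "sgn (x + e *\<^sub>R p) \<in> T"
      by (rule sph_interior_perturb)
    have "p \<bullet> (x + e *\<^sub>R p) > 0"
      using x e(1) assms by (simp add: great_hypersphere_def inner_add_right dot_square_norm)
    then have "sgn (x + e *\<^sub>R p) \<in> ?H"
      using e(2) by (simp add: open_hemisphere_def norm_sgn sgn_div_norm)
    then show "\<exists>y. y \<in> ?H \<and> y \<in> T" using e(3) by blast
  qed
  show ?thesis unfolding frontier_of_def int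
  proof
    show "top_of_set ?S closure_of ?H - ?H \<subseteq> great_hypersphere p"
      using 1 by (auto simp: open_hemisphere_def closed_hemisphere_def great_hypersphere_def)
    show "great_hypersphere p \<subseteq> top_of_set ?S closure_of ?H - ?H"
      using 2 by (auto simp: open_hemisphere_def great_hypersphere_def)
  qed
qed

text \<open>The direction \<open>sgn (p - r)\<close> separates distinct centres: it has positive
  product with \<open>p\<close> and negative product with \<open>r\<close>. Injectivity is what lets
  cardinalities of centres and of hemispheres agree.\<close>

lemma inj_on_open_hemisphere: "inj_on open_hemisphere (usphere :: 'a::euclidean_space set)"
proof (rule inj_onI, rule ccontr)
  fix p r :: 'a
  assume pr: "p \<in> usphere" "r \<in> usphere" "open_hemisphere p = open_hemisphere r" "p \<noteq> r"
  have n: "p \<bullet> p = 1" "r \<bullet> r = 1" using pr by (auto simp: dot_square_norm)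
  have "(p - r) \<bullet> (p - r) > 0" using pr(4) by simp
  then have *: "p \<bullet> r < 1" using n by (simp add: inner_diff_left inner_diff_right inner_commute)
  have "sgn (p - r) \<in> open_hemisphere p"
    using pr(4) * n by (simp add: open_hemisphere_def norm_sgn sgn_div_norm inner_diff_right)
  then have "sgn (p - r) \<in> open_hemisphere r" using pr(3) by simp
  then show False
    using pr(4) * n
    by (simp add: open_hemisphere_def sgn_div_norm inner_diff_right inner_commute zero_less_mult_iff)
qed

section \<open>A fixed convex body and its polar: interiors and boundary\<close>

locale sph_body =
  fixes K :: "'a::euclidean_space set"
  assumes body: "sph_convex_body K"
begin

abbreviation "P \<equiv> sph_polar K"

lemma compact_K: "compact K"
  using body by (simp add: sph_convex_body_def)

lemma K_subset_sphere: "K \<subseteq> usphere"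
  using body by (auto simp: sph_convex_body_def sph_convex_def open_hemisphere_def)

lemma polar_subset_sphere: "P \<subseteq> usphere"
  by (auto simp: sph_polar_def)

lemma K_nonempty: "K \<noteq> {}"
  using body interior_of_subset by (fastforce simp: sph_convex_body_def)

lemma hemisphereE:
  obtains w where "w \<in> usphere" "K \<subseteq> open_hemisphere w"
  using body unfolding sph_convex_body_def sph_convex_def by blast

lemma polar_polar: "sph_polar P = K"
  using body K_nonempty by (intro sph_polar_polar) (auto simp: sph_convex_body_def)

lemma polar_inner_le: "x \<in> P \<Longrightarrow> y \<in> K \<Longrightarrow> x \<bullet> y \<le> 0"
  by (simp add: sph_polar_def)

lemma interior_K: "sph_interior K = {y \<in> usphere. \<forall>x\<in>P. x \<bullet> y < 0}"
  using sph_interior_polar[OF compact_sph_polar[of K] polar_subset_sphere] by (simp add: polar_polar)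

lemma interior_polar: "sph_interior P = {z \<in> usphere. \<forall>y\<in>K. z \<bullet> y < 0}"
  using sph_interior_polar[OF compact_K K_subset_sphere] by (simp add: inner_commute)

text \<open>\<open>K\<close> is closed, so its boundary is \<open>K\<close> minus its interior;
  failing one of the strict inequalities that define the interior means equality for some point of
  the polar.\<close>

lemma boundary_K: "sph_boundary K = {q \<in> K. \<exists>x\<in>P. x \<bullet> q = 0}"
proof -
  have "closedin (top_of_set usphere) K"
    using compact_K K_subset_sphere by (simp add: closed_subset compact_imp_closed)
  then have "sph_boundary K = K - sph_interior K"
    by (simp add: frontier_of_def closure_of_closedin)
  then show ?thesis
    using K_subset_sphere polar_inner_le unfolding interior_K by (force simp: not_less)
qed

lemma sgn_in_interior_K:
  assumes "z \<in> P" "\<And>x. x \<in> P \<Longrightarrow> x \<bullet> y < 0"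
  shows "sgn y \<in> sph_interior K"
proof -
  \<comment> \<open>The point \<open>z\<close> shows that \<open>P\<close> is nonempty, so the
    negativity assumption is not vacuous and excludes \<open>y = 0\<close>.\<close>
  have "y \<noteq> 0" using assms by fastforce
  then show ?thesis using assms(2)
    by (auto simp: interior_K norm_sgn sgn_div_norm mult_less_0_iff)
qed

section \<open>Illumination of boundary points and exposed faces of the polar\<close>

lemma illuminated_from_iff:
  assumes z: "z \<in> sph_interior P" and p: "p \<in> usphere" "z \<bullet> p = 0" and q: "q \<in> sph_boundary K"
  shows "illuminated_from K p q \<longleftrightarrow> P \<inter> great_hypersphere q \<subseteq> open_hemisphere p"
proof -
  have zP: "z \<in> P" using z by (rule subsetD[OF interior_of_subset])
  have qK: "q \<in> K" using q by (simp add: boundary_K)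
  have zq: "z \<bullet> q < 0" using z qK by (simp add: interior_polar)
  show ?thesis
  proof
    assume ill: "illuminated_from K p q"
    then obtain y where y: "y \<in> great_circle p q" "y \<in> sph_interior K"
      by (auto simp: illuminated_from_def)
    then obtain a b where ab: "y = a *\<^sub>R p + b *\<^sub>R q"
      by (auto simp: great_circle_def span_insert span_singleton) (metis add.commute diff_add_cancel)
    have yneg: "x \<bullet> y < 0" if "x \<in> P" for x using y that by (simp add: interior_K)
    \<comment> \<open>Pairing with \<open>z\<close> eliminates \<open>p\<close>, which is orthogonal
      to it, and so fixes the sign of \<open>b\<close>; the sign of \<open>a\<close> then follows
      since \<open>y\<close> is not on the segment.\<close>
    have "b * (z \<bullet> q) < 0" using yneg[OF zP] p by (simp add: ab inner_add_right)
    then have "b > 0" using zq by (simp add: mult_less_0_iff)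
    have "a < 0"
    proof (rule ccontr)
      assume "\<not> a < 0"
      then have "y \<in> sph_segment p q"
        using y(2) ab \<open>b > 0\<close> unfolding sph_segment_def interior_K
        by (intro CollectI conjI exI[of _ a] exI[of _ b]) auto
      then show False using ill y(2) by (auto simp: illuminated_from_def)
    qed
    show "P \<inter> great_hypersphere q \<subseteq> open_hemisphere p"
    proof
      fix x assume x: "x \<in> P \<inter> great_hypersphere q"
      then have "a * (x \<bullet> p) < 0"
        using yneg[of x] by (simp add: ab inner_add_right great_hypersphere_def inner_commute)
      then show "x \<in> open_hemisphere p"
        using x \<open>a < 0\<close> by (auto simp: mult_less_0_iff open_hemisphere_def inner_commute great_hypersphere_def)
    qed
  next
    assume face: "P \<inter> great_hypersphere q \<subseteq> open_hemisphere p"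
    have pos: "x \<bullet> p > 0" if "x \<in> P" "x \<bullet> q = 0" for x
    proof -
      have "x \<in> P \<inter> great_hypersphere q"
        using that polar_subset_sphere by (auto simp: great_hypersphere_def inner_commute)
      then have "x \<in> open_hemisphere p" using face by (rule subsetD[rotated])
      then show ?thesis by (simp add: open_hemisphere_def inner_commute)
    qed
    \<comment> \<open>Only polar points with \<open>x \<bullet> p \<le> 0\<close> could spoil a move
      from \<open>q\<close> along \<open>- p\<close>. They form a compact set off the face of
      \<open>q\<close>, so \<open>q\<close> is strictly negative on it and stays so after a small
      move.\<close>
    define P0 where "P0 = P \<inter> {x. x \<bullet> p \<le> 0}"
    have "closed {x. x \<bullet> p \<le> 0}" by (intro closed_Collect_le continuous_intros)
    then have P0_compact: "compact P0" by (simp add: P0_def compact_Int_closed compact_sph_polar)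
    have "q \<in> {y. \<forall>x\<in>P0. x \<bullet> y < 0}"
      using pos polar_inner_le[OF _ qK] by (force simp: P0_def)
    then obtain e where e: "e > 0" "ball q e \<subseteq> {y. \<forall>x\<in>P0. x \<bullet> y < 0}"
      by (rule openE[OF open_inner_less_zero[OF P0_compact]])
    define s where "s = e / 2"
    have "s > 0" using e by (simp add: s_def)
    have "q - s *\<^sub>R p \<in> ball q e" using e(1) p by (simp add: dist_norm s_def)
    then have P0: "x \<bullet> (q - s *\<^sub>R p) < 0" if "x \<in> P0" for x using e(2) that by blast
    have neg: "x \<bullet> (q - s *\<^sub>R p) < 0" if x: "x \<in> P" for x
    proof (cases "x \<in> P0")
      case False
      then have "s * (x \<bullet> p) > 0" using x \<open>s > 0\<close> by (simp add: P0_def)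
      then show ?thesis using polar_inner_le[OF x qK] by (simp add: inner_diff_right)
    qed (rule P0)
    have "sgn (q - s *\<^sub>R p) \<in> sph_interior K" using sgn_in_interior_K[OF zP neg] .
    moreover from this have "sgn (q - s *\<^sub>R p) \<in> great_circle p q"
      unfolding great_circle_def sgn_div_norm
      by (intro IntI span_mul span_diff span_base) (auto simp: interior_K)
    \<comment> \<open>A face point \<open>x\<close> has product at least 0 with every point of the
      segment, whereas interior points of \<open>K\<close> have negative product with all of
      \<open>P\<close>.\<close>
    moreover have "sph_segment p q \<inter> sph_interior K = {}"
    proof -
      obtain x where x: "x \<in> P" "x \<bullet> q = 0" using q by (auto simp: boundary_K)
      have False if "a \<ge> 0" "a *\<^sub>R p + b *\<^sub>R q \<in> sph_interior K" for a b
      proof -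
        have "a * (x \<bullet> p) < 0" using that(2) x by (auto simp: interior_K inner_add_right)
        then show False using that(1) pos[OF x] by (simp add: mult_less_0_iff)
      qed
      then show ?thesis by (auto simp: sph_segment_def)
    qed
    moreover have "q \<noteq> - p" using zq p by auto
    ultimately show "illuminated_from K p q" by (auto simp: illuminated_from_def)
  qed
qed

text \<open>Supporting normals of \<open>P\<close> are the negatives of points of the bipolar, which
  is \<open>K\<close>; the sign flips because polars use \<open>\<le> 0\<close> and closed
  hemispheres \<open>\<ge> 0\<close>. The greatsphere meets \<open>P\<close> exactly when that point
  of \<open>K\<close> is a boundary point.\<close>

lemma exposed_face_polar_iff:
  "sph_exposed_face_of F P \<longleftrightarrow> (\<exists>q\<in>sph_boundary K. F = P \<inter> great_hypersphere q)"
proof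
  assume "sph_exposed_face_of F P"
  then obtain u where u: "u \<in> usphere" "great_hypersphere u \<inter> P \<noteq> {}" "P \<subseteq> closed_hemisphere u"
    "F = P \<inter> great_hypersphere u" unfolding sph_exposed_face_of_def by blast
  have "- u \<in> sph_polar P" using u(1,3) by (force simp: sph_polar_def[of P] closed_hemisphere_def)
  then have "- u \<in> K" by (simp add: polar_polar)
  then have "- u \<in> sph_boundary K"
    using u(2) by (auto simp: boundary_K great_hypersphere_def inner_commute)
  moreover have "F = P \<inter> great_hypersphere (- u)" using u(4) by (simp add: great_hypersphere_def)
  ultimately show "\<exists>q\<in>sph_boundary K. F = P \<inter> great_hypersphere q" by blast
next
  assume "\<exists>q\<in>sph_boundary K. F = P \<inter> great_hypersphere q"
  then obtain q x where q: "q \<in> K" "x \<in> P" "x \<bullet> q = 0" "F = P \<inter> great_hypersphere q"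
    by (auto simp: boundary_K)
  have "- q \<in> usphere" using q(1) K_subset_sphere by auto
  moreover have "x \<in> great_hypersphere (- q) \<inter> P"
    using q polar_subset_sphere by (auto simp: great_hypersphere_def inner_commute)
  moreover have "P \<subseteq> closed_hemisphere (- q)"
    using polar_inner_le[OF _ q(1)] polar_subset_sphere
    by (auto simp: closed_hemisphere_def inner_commute)
  moreover have "F = P \<inter> great_hypersphere (- q)" using q(4) by (simp add: great_hypersphere_def)
  ultimately show "sph_exposed_face_of F P" unfolding sph_exposed_face_of_def by blast
qed

section \<open>Greatspheres missing the body, and covers as illuminating sets\<close>

lemma disjoint_great_hypersphere:
  assumes "z \<in> sph_interior P"
  shows "great_hypersphere z \<inter> K = {}"
  using assms by (force simp: interior_polar great_hypersphere_def)

text \<open>By convexity \<open>K\<close> lies strictly on one side of a greatsphere that misses it,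
  so one of the two unit normals is an interior point of the polar.\<close>

lemma disjoint_great_hypersphereE:
  assumes u: "u \<in> usphere" "great_hypersphere u \<inter> K = {}"
  obtains z where "z \<in> sph_interior P" "great_hypersphere z = great_hypersphere u"
proof -
  have nz: "u \<bullet> y \<noteq> 0" if "y \<in> K" for y
    using u that K_subset_sphere unfolding great_hypersphere_def by blast
  have sc: "sph_segment x y \<subseteq> K" if "x \<in> K" "y \<in> K" for x y
    using body that by (simp add: sph_convex_body_def sph_convex_def)
  obtain w where w: "K \<subseteq> open_hemisphere w"
    by (rule hemisphereE)
  have False if xy: "x \<in> K" "y \<in> K" "u \<bullet> x < 0" "u \<bullet> y > 0" for x y
  proof -
    \<comment> \<open>The weights are positive and chosen so that \<open>u \<bullet> v = 0\<close>:
      this is where the segment from \<open>x\<close> to \<open>y\<close> crosses the greatsphere.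
      The hemisphere around \<open>w\<close> ensures \<open>v \<noteq> 0\<close>.\<close>
    define v where "v = (u \<bullet> y) *\<^sub>R x + (- (u \<bullet> x)) *\<^sub>R y"
    have "w \<bullet> x > 0" "w \<bullet> y > 0" using w xy by (auto simp: open_hemisphere_def)
    then have "w \<bullet> v > 0" using xy unfolding v_def inner_add_right inner_scaleR_right
      by (intro add_pos_pos mult_pos_pos) auto
    then have "v \<noteq> 0" by auto
    have "sgn v = (inverse (norm v) * (u \<bullet> y)) *\<^sub>R x + (inverse (norm v) * (- (u \<bullet> x))) *\<^sub>R y"
      by (simp add: sgn_div_norm v_def scaleR_diff_right)
    moreover have "inverse (norm v) * (u \<bullet> y) \<ge> 0" "inverse (norm v) * (- (u \<bullet> x)) \<ge> 0"
      using xy by (intro mult_nonneg_nonneg; simp)+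
    moreover have "sgn v \<in> usphere" using \<open>v \<noteq> 0\<close> by (simp add: norm_sgn)
    ultimately have "sgn v \<in> sph_segment x y" unfolding sph_segment_def by blast
    then have "sgn v \<in> K" using sc xy by blast
    moreover have "u \<bullet> sgn v = 0" by (simp add: sgn_div_norm v_def inner_diff_right)
    ultimately show False using nz by blast
  qed
  then consider "\<forall>y\<in>K. u \<bullet> y < 0" | "\<forall>y\<in>K. u \<bullet> y > 0" using nz by (metis linorder_less_linear)
  then show thesis
  proof cases
    case 1
    then show thesis using u by (intro that[of u]) (auto simp: interior_polar)
  next
    case 2
    then show thesis using u
      by (intro that[of "- u"]) (auto simp: interior_polar great_hypersphere_def)
  qed
qed

lemma illuminates_iff_cover:
  assumes z: "z \<in> sph_interior P" and S: "S \<subseteq> great_hypersphere z"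
  shows "illuminates S K \<longleftrightarrow> (\<forall>F. sph_exposed_face_of F P \<longrightarrow> (\<exists>H\<in>open_hemisphere ` S. F \<subseteq> H))"
proof -
  have "S \<subseteq> usphere - K"
    using S disjoint_great_hypersphere[OF z] by (auto simp: great_hypersphere_def)
  moreover have "illuminated_from K p q \<longleftrightarrow> P \<inter> great_hypersphere q \<subseteq> open_hemisphere p"
    if "p \<in> S" "q \<in> sph_boundary K" for p q
    using that S by (intro illuminated_from_iff[OF z]) (auto simp: great_hypersphere_def)
  ultimately show ?thesis by (auto simp: illuminates_def exposed_face_polar_iff) blast+
qed

text \<open>Orthogonality is symmetric: \<open>z\<close> lies on the boundary of the hemisphere
  centred at \<open>p\<close> iff \<open>p\<close> lies on the greatsphere with normal
  \<open>z\<close>. A common boundary point in the interior of the polar thus amounts to centres on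
  one greatsphere disjoint from \<open>K\<close>.\<close>

lemma cover_iff_illuminates:
  "hemisphere_cover_of_polar_faces K \<H> \<longleftrightarrow>
    (\<exists>S. \<H> = open_hemisphere ` S \<and> illuminates S K \<and>
         (\<exists>u\<in>usphere. great_hypersphere u \<inter> K = {} \<and> S \<subseteq> great_hypersphere u))"
proof
  assume "hemisphere_cover_of_polar_faces K \<H>"
  then obtain z where *: "\<H> \<subseteq> open_hemisphere ` usphere" "z \<in> sph_interior P"
    "\<forall>H\<in>\<H>. z \<in> sph_boundary H" "\<forall>F. sph_exposed_face_of F P \<longrightarrow> (\<exists>H\<in>\<H>. F \<subseteq> H)"
    unfolding hemisphere_cover_of_polar_faces_def by blast
  obtain S where S: "S \<subseteq> usphere" "\<H> = open_hemisphere ` S" using *(1) unfolding subset_image_iff by blast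
  have "S \<subseteq> great_hypersphere z"
  proof
    fix p assume "p \<in> S"
    then have p: "p \<in> usphere" "z \<in> sph_boundary (open_hemisphere p)" using S *(3) by auto
    then have "z \<in> great_hypersphere p" using sph_boundary_open_hemisphere[OF p(1)] by simp
    then show "p \<in> great_hypersphere z" using p by (simp add: great_hypersphere_def inner_commute)
  qed
  moreover from this have "illuminates S K" using illuminates_iff_cover[OF *(2)] *(4) S(2) by simp
  moreover have "z \<in> usphere" using *(2) by (simp add: interior_polar)
  ultimately show "\<exists>S. \<H> = open_hemisphere ` S \<and> illuminates S K \<and>
         (\<exists>u\<in>usphere. great_hypersphere u \<inter> K = {} \<and> S \<subseteq> great_hypersphere u)"
    using S(2) disjoint_great_hypersphere[OF *(2)] by blast
next
  assume "\<exists>S. \<H> = open_hemisphere ` S \<and> illuminates S K \<and>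
         (\<exists>u\<in>usphere. great_hypersphere u \<inter> K = {} \<and> S \<subseteq> great_hypersphere u)"
  then obtain S u where S: "\<H> = open_hemisphere ` S" "illuminates S K" "u \<in> usphere"
    "great_hypersphere u \<inter> K = {}" "S \<subseteq> great_hypersphere u" by blast
  obtain z where z: "z \<in> sph_interior P" "great_hypersphere z = great_hypersphere u"
    using disjoint_great_hypersphereE[OF S(3,4)] .
  have Sz: "S \<subseteq> great_hypersphere z" using S(5) z(2) by simp
  have "z \<in> sph_boundary (open_hemisphere p)" if "p \<in> S" for p
  proof -
    have "p \<in> usphere" "p \<bullet> z = 0" "z \<in> usphere"
      using Sz z(1) that by (auto simp: great_hypersphere_def inner_commute interior_polar)
    then have "z \<in> great_hypersphere p" by (simp add: great_hypersphere_def)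
    then show ?thesis using sph_boundary_open_hemisphere[OF \<open>p \<in> usphere\<close>] by simp
  qed
  moreover have "\<H> \<subseteq> open_hemisphere ` usphere"
    using Sz S(1) by (auto simp: great_hypersphere_def)
  moreover have "\<forall>F. sph_exposed_face_of F P \<longrightarrow> (\<exists>H\<in>\<H>. F \<subseteq> H)"
    using illuminates_iff_cover[OF z(1) Sz] S(1,2) by simp
  ultimately show "hemisphere_cover_of_polar_faces K \<H>"
    using z(1) S(1) unfolding hemisphere_cover_of_polar_faces_def by blast
qed

section \<open>Existence of a finite illuminating set\<close>

lemma finite_illuminating_set_exists:
  obtains S u where "finite S" "illuminates S K" "u \<in> usphere" "great_hypersphere u \<inter> K = {}"
    "S \<subseteq> great_hypersphere u"
proof -
  obtain w where w: "w \<in> usphere" "K \<subseteq> open_hemisphere w"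
    by (rule hemisphereE)
  define z where "z = - w"
  have zs: "z \<in> usphere" and zK: "\<And>y. y \<in> K \<Longrightarrow> z \<bullet> y < 0"
    using w by (auto simp: z_def open_hemisphere_def)
  then have z: "z \<in> sph_interior P" by (simp add: interior_polar)
  obtain m where m: "m \<in> sph_interior K" using body unfolding sph_convex_body_def by blast
  then have mK: "m \<in> K" by (rule subsetD[OF interior_of_subset])
  have mP: "x \<bullet> m < 0" if "x \<in> P" for x using m that by (simp add: interior_K)
  \<comment> \<open>For \<open>q\<close> in \<open>V p\<close>, a point of \<open>P\<close>
    orthogonal to \<open>q\<close> must have positive product with \<open>p\<close>. This makes the
    face condition open in \<open>q\<close>, ready for a finite subcover.\<close>
  define V where "V p = {q. \<forall>x\<in>P \<inter> {x. x \<bullet> p \<le> 0}. x \<bullet> q < 0}" for p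
  have V: "open (V p)" for p
  proof -
    have "closed {x. x \<bullet> p \<le> 0}" by (intro closed_Collect_le continuous_intros)
    then show ?thesis unfolding V_def
      by (intro open_inner_less_zero compact_Int_closed compact_sph_polar)
  qed
  have "\<exists>p\<in>great_hypersphere z. q \<in> V p" if q: "q \<in> sph_boundary K" for q
  proof -
    \<comment> \<open>The direction pointing from \<open>m\<close> to \<open>q\<close>, after scaling \<open>m\<close> so that it becomes orthogonal to \<open>z\<close>.\<close>
    define c where "c = z \<bullet> q / (z \<bullet> m)"
    define v where "v = q - c *\<^sub>R m"
    have qK: "q \<in> K" using q by (simp add: boundary_K)
    have "z \<bullet> q < 0" "z \<bullet> m < 0" using zK qK mK by auto
    then have "c > 0" by (simp add: c_def divide_neg_neg)
    have zv: "z \<bullet> v = 0" using \<open>z \<bullet> m < 0\<close> by (simp add: v_def c_def inner_diff_right)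
    \<comment> \<open>On the face of \<open>q\<close> only the term with \<open>m\<close> survives,
      and it is positive because \<open>m\<close> is interior to \<open>K\<close>.\<close>
    have pos: "x \<bullet> v > 0" if "x \<in> P" "x \<bullet> q = 0" for x
      using mP[OF that(1)] that(2) \<open>c > 0\<close> by (simp add: v_def inner_diff_right mult_pos_neg)
    have "v \<noteq> 0" using pos q by (force simp: boundary_K)
    have "sgn v \<in> great_hypersphere z"
      using zv \<open>v \<noteq> 0\<close> by (simp add: great_hypersphere_def norm_sgn sgn_div_norm)
    moreover have "q \<in> V (sgn v)"
      unfolding V_def
    proof (intro CollectI ballI)
      fix x assume x: "x \<in> P \<inter> {x. x \<bullet> sgn v \<le> 0}"
      then have "x \<bullet> v \<le> 0" using \<open>v \<noteq> 0\<close> by (simp add: sgn_div_norm mult_le_0_iff)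
      then show "x \<bullet> q < 0" using x pos[of x] polar_inner_le[OF _ qK, of x] by force
    qed
    ultimately show ?thesis by blast
  qed
  then have "sph_boundary K \<subseteq> (\<Union>p\<in>great_hypersphere z. V p)" by blast
  moreover have "compact (sph_boundary K)"
  proof -
    have "closedin (top_of_set usphere) (sph_boundary K)" by (rule closedin_frontier_of)
    then show ?thesis by (rule closedin_compact[OF compact_sphere])
  qed
  ultimately obtain S where S: "S \<subseteq> great_hypersphere z" "finite S" "sph_boundary K \<subseteq> (\<Union>p\<in>S. V p)"
    using V by (metis compactE_image)
  have "illuminates S K"
    unfolding illuminates_iff_cover[OF z S(1)] exposed_face_polar_iff
  proof (intro allI impI)
    fix F assume "\<exists>q\<in>sph_boundary K. F = P \<inter> great_hypersphere q"
    then obtain q where q: "q \<in> sph_boundary K" "F = P \<inter> great_hypersphere q" by blast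
    then obtain p where p: "p \<in> S" "q \<in> V p" using S(3) by blast
    have "F \<subseteq> open_hemisphere p"
      using p(2) by (force simp: q(2) V_def great_hypersphere_def open_hemisphere_def inner_commute)
    then show "\<exists>H\<in>open_hemisphere ` S. F \<subseteq> H" using p(1) by blast
  qed
  then show thesis using that[OF S(2) _ zs disjoint_great_hypersphere[OF z] S(1)] by blast
qed

section \<open>Comparison of the two minima\<close>

text \<open>Both infima range over the same set of cardinalities: \<open>open_hemisphere\<close> is
  injective on the sphere, so sizes and finiteness transfer in both directions.\<close>

lemma illumination_number_eq:
  "illumination_number K = Inf {enat (card \<H>) | \<H>. finite \<H> \<and> hemisphere_cover_of_polar_faces K \<H>}"
proof -
  let ?ok = "\<lambda>S. illuminates S K \<and>
    (\<exists>u\<in>usphere. great_hypersphere u \<inter> K = {} \<and> S \<subseteq> great_hypersphere u)"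
  have inj: "inj_on open_hemisphere S" if "?ok S" for S
    using that by (intro inj_on_subset[OF inj_on_open_hemisphere]) (auto simp: illuminates_def)
  have "{enat (card S) | S. finite S \<and> ?ok S} =
    {enat (card \<H>) | \<H>. finite \<H> \<and> hemisphere_cover_of_polar_faces K \<H>}"
  proof (intro subset_antisym subsetI)
    fix n assume "n \<in> {enat (card S) | S. finite S \<and> ?ok S}"
    then obtain S where S: "n = enat (card S)" "finite S" "?ok S" by blast
    then have "n = enat (card (open_hemisphere ` S))" using inj by (simp add: card_image)
    moreover have "hemisphere_cover_of_polar_faces K (open_hemisphere ` S)"
      using S(3) cover_iff_illuminates by blast
    ultimately show "n \<in> {enat (card \<H>) | \<H>. finite \<H> \<and> hemisphere_cover_of_polar_faces K \<H>}"
      using S(2) by blast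
  next
    fix n assume "n \<in> {enat (card \<H>) | \<H>. finite \<H> \<and> hemisphere_cover_of_polar_faces K \<H>}"
    then obtain \<H> where H: "n = enat (card \<H>)" "finite \<H>" "hemisphere_cover_of_polar_faces K \<H>"
      by blast
    then obtain S where S: "\<H> = open_hemisphere ` S" "?ok S"
      unfolding cover_iff_illuminates by blast
    then have "n = enat (card S)" "finite S" using H(1,2) inj by (auto simp: card_image dest: finite_imageD)
    then show "n \<in> {enat (card S) | S. finite S \<and> ?ok S}" using S(2) by blast
  qed
  then show ?thesis by (simp add: illumination_number_def)
qed

end

theorem theorem4:
  fixes K :: "'a::euclidean_space set"
  assumes "sph_convex_body K"
  shows "(\<exists>\<H>. finite \<H> \<and> hemisphere_cover_of_polar_faces K \<H> \<and>
               illumination_number K = enat (card \<H>)) \<and>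
         (\<forall>\<H>. finite \<H> \<and> hemisphere_cover_of_polar_faces K \<H> \<longrightarrow>
               illumination_number K \<le> enat (card \<H>))"
proof -
  interpret sph_body K by unfold_locales (rule assms)
  let ?A = "{enat (card \<H>) | \<H>. finite \<H> \<and> hemisphere_cover_of_polar_faces K \<H>}"
  obtain S u where "finite S" "illuminates S K" "u \<in> usphere" "great_hypersphere u \<inter> K = {}"
    "S \<subseteq> great_hypersphere u"
    by (rule finite_illuminating_set_exists)
  then have "finite (open_hemisphere ` S)" "hemisphere_cover_of_polar_faces K (open_hemisphere ` S)"
    unfolding cover_iff_illuminates by blast+
  then have "?A \<noteq> {}" by blast
  \<comment> \<open>A nonempty set of extended naturals attains its infimum; the value
    \<open>\<infinity>\<close> for the empty set has just been ruled out.\<close>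
  then have "Inf ?A \<in> ?A" unfolding Inf_enat_def by (auto intro: LeastI)
  moreover have "Inf ?A \<le> enat (card \<H>)" if "finite \<H>" "hemisphere_cover_of_polar_faces K \<H>" for \<H>
    using that by (intro Inf_lower) blast
  ultimately show ?thesis unfolding illumination_number_eq by auto
qed

end
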